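(* Let $(M,J,g)$ be an almost Norden manifold with associated metric $\widetilde g(X,Y)=g(X,JY)$, and let $\nabla$ be a symmetric (torsion-free) linear connection on $M$. Then: (i) the conjugate connections of $\nabla$ relative to $g$ and to $J$ coincide if and only if $\nabla$ is the Levi-Civita connection $\widetilde\nabla^0$ of $\widetilde g$; (ii) the conjugate connections of $\nabla$ relative to $\widetilde g$ and to $J$ coincide if and only if $\nabla$ is the Levi-Civita connection $\nabla^0$ of $g$.
   Context: An almost Norden manifold $(M,J,g)$ is a differentiable $2n$-dimensional manifold $M$ with an almost complex structure $J$ ($J^2=-\mathrm{id}$) and a pseudo-Riemannian metric $g$ such that $g(JX,JY)=-g(X,Y)$. Then $\widetilde g(X,Y)=g(X,JY)$ is also a (symmetric, nondegenerate) pseudo-Riemannian metric. The conjugate connection of a linear connection $\nabla$ relative to a pseudo-Riemannian metric $h$ is the linear connection $\nabla^\ast$ determined by $X h(Y,Z)=h(\nabla_XY,Z)+h(Y,\nabla^\ast_XZ)$. The conjugate connection of $\nabla$ relative to $J$ (complex conjugate connection) is the linear connection $\nabla^\ast_XY=-J\nabla_X(JY)=\nabla_XY-J(\nabla_XJ)Y$. *)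

theory Defs
  imports "HOL-Analysis.Analysis"
begin

section \<open>Smooth manifolds\<close>

text \<open>
  \<open>C_k k S f\<close> and \<open>smooth_on S f\<close> are meant for open sets \<open>S\<close> of a Euclidean space, where
  being \<open>C\<^sup>k\<^sup>+\<^sup>1\<close> amounts to being differentiable with all directional derivatives \<open>C\<^sup>k\<close>.
\<close>

primrec C_k :: "nat \<Rightarrow> 'e set \<Rightarrow> ('e::euclidean_space \<Rightarrow> 'f::real_normed_vector) \<Rightarrow> bool" where
  "C_k 0 S f \<longleftrightarrow> continuous_on S f"
| "C_k (Suc k) S f \<longleftrightarrow>
     (\<forall>x\<in>S. f differentiable (at x)) \<and> (\<forall>v. C_k k S (\<lambda>x. frechet_derivative f (at x) v))"

definition smooth_on :: "'e set \<Rightarrow> ('e::euclidean_space \<Rightarrow> 'f::real_normed_vector) \<Rightarrow> bool" where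
  "smooth_on S f \<longleftrightarrow> (\<forall>k. C_k k S f)"

text \<open>
  The manifold is the whole of a Hausdorff, second countable topological type \<open>'a\<close>, with a smooth
  structure given by an atlas of charts \<open>(U, \<phi>)\<close> into the Euclidean space \<open>'e\<close>.
\<close>

type_synonym ('a, 'e) atlas = "('a set \<times> ('a \<Rightarrow> 'e)) set"

definition smooth_atlas ::
    "('a::{t2_space, second_countable_topology}, 'e::euclidean_space) atlas \<Rightarrow> bool" where
  "smooth_atlas A \<longleftrightarrow>
     (\<Union>(U, \<phi>)\<in>A. U) = UNIV \<and>
     (\<forall>(U, \<phi>)\<in>A. open U \<and> open (\<phi> ` U) \<and> homeomorphism U (\<phi> ` U) \<phi> (inv_into U \<phi>)) \<and>
     (\<forall>(U, \<phi>)\<in>A. \<forall>(V, \<psi>)\<in>A. smooth_on (\<phi> ` (U \<inter> V)) (\<psi> \<circ> inv_into U \<phi>))"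

definition smooth_functions ::
    "('a::topological_space, 'e::euclidean_space) atlas \<Rightarrow> ('a \<Rightarrow> real) set" where
  "smooth_functions A = {f. \<forall>(U, \<phi>)\<in>A. smooth_on (\<phi> ` U) (f \<circ> inv_into U \<phi>)}"

text \<open>
  A tangent vector at \<open>p\<close> is a derivation at \<open>p\<close> of the algebra of smooth functions.  It is set to
  \<open>0\<close> on the functions that are not smooth, so that tangent vectors are equal as HOL functions iff
  they are equal as derivations.
\<close>

type_synonym 'a tvec = "('a \<Rightarrow> real) \<Rightarrow> real"

type_synonym 'a vfield = "'a \<Rightarrow> 'a tvec"

definition tangent_space ::
    "('a::topological_space, 'e::euclidean_space) atlas \<Rightarrow> 'a \<Rightarrow> 'a tvec set" where
  "tangent_space A p = {v.
     (\<forall>f\<in>smooth_functions A. \<forall>g\<in>smooth_functions A. \<forall>a b.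
        v (\<lambda>q. a * f q + b * g q) = a * v f + b * v g) \<and>
     (\<forall>f\<in>smooth_functions A. \<forall>g\<in>smooth_functions A.
        v (\<lambda>q. f q * g q) = f p * v g + g p * v f) \<and>
     (\<forall>f. f \<notin> smooth_functions A \<longrightarrow> v f = 0)}"

definition tzero :: "'a tvec" where
  "tzero = (\<lambda>f. 0)"

definition tlin :: "real \<Rightarrow> 'a tvec \<Rightarrow> real \<Rightarrow> 'a tvec \<Rightarrow> 'a tvec" where
  "tlin a v b w = (\<lambda>f. a * v f + b * w f)"

definition vector_fields ::
    "('a::topological_space, 'e::euclidean_space) atlas \<Rightarrow> 'a vfield set" where
  "vector_fields A = {X. (\<forall>p. X p \<in> tangent_space A p) \<and>
     (\<forall>f\<in>smooth_functions A. (\<lambda>p. X p f) \<in> smooth_functions A)}"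

definition lie_bracket :: "'a vfield \<Rightarrow> 'a vfield \<Rightarrow> 'a vfield" where
  "lie_bracket X Y = (\<lambda>p f. X p (\<lambda>q. Y q f) - Y p (\<lambda>q. X q f))"

section \<open>Metrics and almost Norden structures\<close>

definition pseudo_riemannian_metric ::
    "('a::topological_space, 'e::euclidean_space) atlas \<Rightarrow>
     ('a \<Rightarrow> 'a tvec \<Rightarrow> 'a tvec \<Rightarrow> real) \<Rightarrow> bool" where
  "pseudo_riemannian_metric A h \<longleftrightarrow>
     (\<forall>p. \<forall>u\<in>tangent_space A p. \<forall>v\<in>tangent_space A p. \<forall>w\<in>tangent_space A p. \<forall>a b.
        h p (tlin a u b v) w = a * h p u w + b * h p v w) \<and>
     (\<forall>p. \<forall>u\<in>tangent_space A p. \<forall>v\<in>tangent_space A p. h p u v = h p v u) \<and>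
     (\<forall>p. \<forall>u\<in>tangent_space A p. (\<forall>v\<in>tangent_space A p. h p u v = 0) \<longrightarrow> u = tzero) \<and>
     (\<forall>X\<in>vector_fields A. \<forall>Y\<in>vector_fields A. (\<lambda>p. h p (X p) (Y p)) \<in> smooth_functions A)"

definition almost_complex_structure ::
    "('a::topological_space, 'e::euclidean_space) atlas \<Rightarrow> ('a \<Rightarrow> 'a tvec \<Rightarrow> 'a tvec) \<Rightarrow> bool" where
  "almost_complex_structure A J \<longleftrightarrow>
     (\<forall>p. \<forall>u\<in>tangent_space A p. J p u \<in> tangent_space A p) \<and>
     (\<forall>p. \<forall>u\<in>tangent_space A p. \<forall>v\<in>tangent_space A p. \<forall>a b.
        J p (tlin a u b v) = tlin a (J p u) b (J p v)) \<and>
     (\<forall>p. \<forall>u\<in>tangent_space A p. J p (J p u) = (\<lambda>f. - u f)) \<and>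
     (\<forall>X\<in>vector_fields A. (\<lambda>p. J p (X p)) \<in> vector_fields A)"

definition almost_norden_manifold ::
    "nat \<Rightarrow> ('a::{t2_space, second_countable_topology}, 'e::euclidean_space) atlas \<Rightarrow>
     ('a \<Rightarrow> 'a tvec \<Rightarrow> 'a tvec) \<Rightarrow> ('a \<Rightarrow> 'a tvec \<Rightarrow> 'a tvec \<Rightarrow> real) \<Rightarrow> bool" where
  "almost_norden_manifold n A J g \<longleftrightarrow>
     DIM('e) = 2 * n \<and> smooth_atlas A \<and>
     almost_complex_structure A J \<and> pseudo_riemannian_metric A g \<and>
     (\<forall>p. \<forall>u\<in>tangent_space A p. \<forall>v\<in>tangent_space A p. g p (J p u) (J p v) = - g p u v)"

definition associated_metric ::
    "('a \<Rightarrow> 'a tvec \<Rightarrow> 'a tvec) \<Rightarrow> ('a \<Rightarrow> 'a tvec \<Rightarrow> 'a tvec \<Rightarrow> real) \<Rightarrow>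
     ('a \<Rightarrow> 'a tvec \<Rightarrow> 'a tvec \<Rightarrow> real)" where
  "associated_metric J g = (\<lambda>p u v. g p u (J p v))"

section \<open>Linear connections\<close>

text \<open>
  A linear connection \<open>D\<close> sends vector fields \<open>X\<close>, \<open>Y\<close> to the covariant derivative \<open>D X Y\<close> of
  \<open>Y\<close> along \<open>X\<close>; its values on arguments that are not vector fields are irrelevant.
\<close>

type_synonym 'a connection = "'a vfield \<Rightarrow> 'a vfield \<Rightarrow> 'a vfield"

definition linear_connection ::
    "('a::topological_space, 'e::euclidean_space) atlas \<Rightarrow> 'a connection \<Rightarrow> bool" where
  "linear_connection A D \<longleftrightarrow>
     (\<forall>X\<in>vector_fields A. \<forall>Y\<in>vector_fields A. D X Y \<in> vector_fields A) \<and>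
     (\<forall>X\<in>vector_fields A. \<forall>Y\<in>vector_fields A. \<forall>Z\<in>vector_fields A.
        \<forall>a\<in>smooth_functions A. \<forall>b\<in>smooth_functions A.
        D (\<lambda>p. tlin (a p) (X p) (b p) (Y p)) Z = (\<lambda>p. tlin (a p) (D X Z p) (b p) (D Y Z p))) \<and>
     (\<forall>X\<in>vector_fields A. \<forall>Y\<in>vector_fields A. \<forall>Z\<in>vector_fields A.
        D X (\<lambda>p. tlin 1 (Y p) 1 (Z p)) = (\<lambda>p. tlin 1 (D X Y p) 1 (D X Z p))) \<and>
     (\<forall>X\<in>vector_fields A. \<forall>Y\<in>vector_fields A. \<forall>a\<in>smooth_functions A.
        D X (\<lambda>p f. a p * Y p f) = (\<lambda>p. tlin (X p a) (Y p) (a p) (D X Y p)))"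

definition torsion_free ::
    "('a::topological_space, 'e::euclidean_space) atlas \<Rightarrow> 'a connection \<Rightarrow> bool" where
  "torsion_free A D \<longleftrightarrow>
     (\<forall>X\<in>vector_fields A. \<forall>Y\<in>vector_fields A.
        (\<lambda>p f. D X Y p f - D Y X p f) = lie_bracket X Y)"

definition levi_civita_connection ::
    "('a::topological_space, 'e::euclidean_space) atlas \<Rightarrow>
     ('a \<Rightarrow> 'a tvec \<Rightarrow> 'a tvec \<Rightarrow> real) \<Rightarrow> 'a connection \<Rightarrow> bool" where
  "levi_civita_connection A h D \<longleftrightarrow>
     linear_connection A D \<and> torsion_free A D \<and>
     (\<forall>X\<in>vector_fields A. \<forall>Y\<in>vector_fields A. \<forall>Z\<in>vector_fields A. \<forall>p.
        X p (\<lambda>q. h q (Y q) (Z q)) = h p (D X Y p) (Z p) + h p (Y p) (D X Z p))"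

text \<open>\<open>N\<close> is the conjugate connection of \<open>D\<close> relative to the metric \<open>h\<close>.\<close>

definition metric_conjugate ::
    "('a::topological_space, 'e::euclidean_space) atlas \<Rightarrow>
     ('a \<Rightarrow> 'a tvec \<Rightarrow> 'a tvec \<Rightarrow> real) \<Rightarrow> 'a connection \<Rightarrow> 'a connection \<Rightarrow> bool" where
  "metric_conjugate A h D N \<longleftrightarrow>
     linear_connection A N \<and>
     (\<forall>X\<in>vector_fields A. \<forall>Y\<in>vector_fields A. \<forall>Z\<in>vector_fields A. \<forall>p.
        X p (\<lambda>q. h q (Y q) (Z q)) = h p (D X Y p) (Z p) + h p (Y p) (N X Z p))"

text \<open>\<open>N\<close> is the conjugate connection of \<open>D\<close> relative to the almost complex structure \<open>J\<close>.\<close>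

definition complex_conjugate ::
    "('a::topological_space, 'e::euclidean_space) atlas \<Rightarrow>
     ('a \<Rightarrow> 'a tvec \<Rightarrow> 'a tvec) \<Rightarrow> 'a connection \<Rightarrow> 'a connection \<Rightarrow> bool" where
  "complex_conjugate A J D N \<longleftrightarrow>
     linear_connection A N \<and>
     (\<forall>X\<in>vector_fields A. \<forall>Y\<in>vector_fields A.
        N X Y = (\<lambda>p f. - J p (D X (\<lambda>q. J q (Y q)) p) f))"

text \<open>
  Each kind of conjugate of \<open>D\<close> exists and is unique up to its irrelevant values outside the
  vector fields, hence two conjugates of \<open>D\<close> coincide iff one and the same connection is both.
\<close>

end

theory Submission
  imports Defs
begin

text \<open>
  A torsion-free connection is the Levi-Civita connection of \<open>h\<close> iff it is its own conjugate relative
  to \<open>h\<close>. Write \<open>N\<^sub>X Y = - J D\<^sub>X (J Y)\<close>. Since \<open>J N\<^sub>X Y = D\<^sub>X (J Y)\<close> and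
  \<open>N\<^sub>X (J Y) = J D\<^sub>X Y\<close>, replacing \<open>Z\<close> by \<open>J Z\<close> in the condition
  \<open>X g(Y, Z) = g(D\<^sub>X Y, Z) + g(Y, N\<^sub>X Z)\<close> gives the compatibility of \<open>D\<close> with \<open>g(\<cdot>, J \<cdot>)\<close>, and
  the same substitution in the condition for \<open>g(\<cdot>, J \<cdot>)\<close> gives the compatibility of \<open>D\<close> with \<open>- g\<close>.
\<close>

section \<open>Constants and signs for tangent vectors, metrics and connections\<close>

lemma C_k_const: "C_k k S (\<lambda>x. c)"
  by (induction k arbitrary: c) simp_all

lemma smooth_functions_const: "(\<lambda>p. c) \<in> smooth_functions A"
  by (auto simp: smooth_functions_def smooth_on_def comp_def C_k_const)

lemma tangent_space_uminus_arg:
  assumes "v \<in> tangent_space A p" and "f \<in> smooth_functions A"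
  shows "v (\<lambda>q. - f q) = - v f"
proof -
  have "v (\<lambda>q. - 1 * f q + 0 * f q) = - 1 * v f + 0 * v f"
    using assms unfolding tangent_space_def by blast
  then show ?thesis by simp
qed

text \<open>The Leibniz rule for \<open>1 * 1\<close> gives \<open>v 1 = 2 * v 1\<close>, so
  \<open>v\<close> kills the function \<open>1\<close> and, by linearity, all its multiples.\<close>

lemma tangent_space_const:
  assumes "v \<in> tangent_space A p"
  shows "v (\<lambda>q. c) = 0"
proof -
  have "v (\<lambda>q. 1 * 1) = 1 * v (\<lambda>q. 1) + 1 * v (\<lambda>q. 1)"
    using assms smooth_functions_const[of 1 A] unfolding tangent_space_def by fast
  then have "v (\<lambda>q. 1) = 0" by simp
  moreover have "v (\<lambda>q. c * 1 + 0 * 1) = c * v (\<lambda>q. 1) + 0 * v (\<lambda>q. 1)"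
    using assms smooth_functions_const[of 1 A] unfolding tangent_space_def by fast
  ultimately show ?thesis by simp
qed

text \<open>Linearity is postulated in the first slot only, so symmetry is applied before and after.
  The assumption \<open>mv\<close> makes the first swap legitimate; under an almost complex
  structure it comes from \<open>J\<close> applied twice.\<close>

lemma metric_uminus_right:
  assumes h: "pseudo_riemannian_metric A h"
    and u: "u \<in> tangent_space A p" and v: "v \<in> tangent_space A p"
    and mv: "(\<lambda>f. - v f) \<in> tangent_space A p"
  shows "h p u (\<lambda>f. - v f) = - h p u v"
proof -
  have "h p u (\<lambda>f. - v f) = h p (tlin (- 1) v 0 v) u"
    using h u mv by (simp add: pseudo_riemannian_metric_def tlin_def)
  also have "\<dots> = - 1 * h p v u + 0 * h p v u"
    using h u v unfolding pseudo_riemannian_metric_def by blast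
  also have "\<dots> = - h p u v"
    using h u v by (simp add: pseudo_riemannian_metric_def)
  finally show ?thesis .
qed

text \<open>Scaling by a real number is the Leibniz rule for a constant function: with
  \<open>a = - 1\<close> the derivative term \<open>X p a\<close> vanishes.\<close>

lemma linear_connection_uminus:
  assumes D: "linear_connection A D" and X: "X \<in> vector_fields A" and Y: "Y \<in> vector_fields A"
  shows "D X (\<lambda>p f. - Y p f) = (\<lambda>p f. - D X Y p f)"
proof -
  have "\<forall>a\<in>smooth_functions A. D X (\<lambda>p f. a p * Y p f) = (\<lambda>p. tlin (X p a) (Y p) (a p) (D X Y p))"
    using D X Y unfolding linear_connection_def by blast
  from this[rule_format, OF smooth_functions_const[of "- 1"]]
  have "D X (\<lambda>p f. - Y p f) = (\<lambda>p. tlin (X p (\<lambda>q. - 1)) (Y p) (- 1) (D X Y p))"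
    by simp
  moreover have "X p (\<lambda>q. - 1) = 0" for p
    using X tangent_space_const[of "X p" A p] by (auto simp: vector_fields_def)
  ultimately show ?thesis by (simp add: tlin_def)
qed

lemma levi_civita_connection_iff_metric_conjugate_self:
  "levi_civita_connection A h D \<longleftrightarrow> torsion_free A D \<and> metric_conjugate A h D D"
  unfolding levi_civita_connection_def metric_conjugate_def by blast

section \<open>The almost complex structure acting on tangent vectors and vector fields\<close>

locale almost_norden =
  fixes n :: nat
    and A :: "('a::{t2_space, second_countable_topology}, 'e::euclidean_space) atlas"
    and J :: "'a \<Rightarrow> 'a tvec \<Rightarrow> 'a tvec"
    and g :: "'a \<Rightarrow> 'a tvec \<Rightarrow> 'a tvec \<Rightarrow> real"
  assumes almost_norden: "almost_norden_manifold n A J g"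
begin

abbreviation JF :: "'a vfield \<Rightarrow> 'a vfield" where
  "JF X \<equiv> \<lambda>p. J p (X p)"

abbreviation conj_J :: "'a connection \<Rightarrow> 'a connection" where
  "conj_J D \<equiv> \<lambda>X Y p f. - J p (D X (JF Y) p) f"

lemma metric_g: "pseudo_riemannian_metric A g"
  using almost_norden by (simp add: almost_norden_manifold_def)

lemma J_structure: "almost_complex_structure A J"
  using almost_norden by (simp add: almost_norden_manifold_def)

lemma J_tangent: "u \<in> tangent_space A p \<Longrightarrow> J p u \<in> tangent_space A p"
  using J_structure by (simp add: almost_complex_structure_def)

lemma J_tlin:
  "u \<in> tangent_space A p \<Longrightarrow> v \<in> tangent_space A p \<Longrightarrow>
    J p (tlin a u b v) = tlin a (J p u) b (J p v)"
  using J_structure by (simp add: almost_complex_structure_def)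

lemma J_J: "u \<in> tangent_space A p \<Longrightarrow> J p (J p u) = (\<lambda>f. - u f)"
  using J_structure by (simp add: almost_complex_structure_def)

lemma vector_field_tangent: "X \<in> vector_fields A \<Longrightarrow> X p \<in> tangent_space A p"
  by (simp add: vector_fields_def)

lemma J_vector_field: "X \<in> vector_fields A \<Longrightarrow> JF X \<in> vector_fields A"
  using J_structure by (simp add: almost_complex_structure_def)

text \<open>Since \<open>- u\<close> is \<open>J (J u)\<close>, closure under negation follows from
  \<open>J\<close> preserving tangent spaces, with no check of the derivation axioms. The same
  device serves for vector fields below.\<close>

lemma tangent_uminus: "u \<in> tangent_space A p \<Longrightarrow> (\<lambda>f. - u f) \<in> tangent_space A p"
  using J_tangent[OF J_tangent] by (simp add: J_J)

lemma JF_JF: "X \<in> vector_fields A \<Longrightarrow> JF (JF X) = (\<lambda>p f. - X p f)"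
  by (simp add: J_J vector_field_tangent)

lemma vector_field_uminus: "X \<in> vector_fields A \<Longrightarrow> (\<lambda>p f. - X p f) \<in> vector_fields A"
  using J_vector_field[OF J_vector_field] by (simp only: JF_JF)

lemma J_uminus:
  assumes "u \<in> tangent_space A p"
  shows "J p (\<lambda>f. - u f) = (\<lambda>f. - J p u f)"
  using J_tlin[OF assms assms, of "- 1" 0] by (simp add: tlin_def)

lemma g_uminus_right:
  "u \<in> tangent_space A p \<Longrightarrow> v \<in> tangent_space A p \<Longrightarrow> g p u (\<lambda>f. - v f) = - g p u v"
  using metric_uminus_right[OF metric_g] tangent_uminus by blast

lemma g_smooth:
  "X \<in> vector_fields A \<Longrightarrow> Y \<in> vector_fields A \<Longrightarrow> (\<lambda>p. g p (X p) (Y p)) \<in> smooth_functions A"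
  using metric_g by (simp add: pseudo_riemannian_metric_def)

section \<open>The conjugate connection relative to \<open>J\<close>\<close>

lemma linear_connection_conj_J:
  assumes D: "linear_connection A D"
  shows "linear_connection A (conj_J D)"
proof -
  have VF: "D X Y \<in> vector_fields A"
    if "X \<in> vector_fields A" "Y \<in> vector_fields A" for X Y
    using D that by (simp add: linear_connection_def)
  have T: "D X Y p \<in> tangent_space A p"
    if "X \<in> vector_fields A" "Y \<in> vector_fields A" for X Y p
    using VF that vector_field_tangent by blast
  show ?thesis
    unfolding linear_connection_def
  proof (intro conjI ballI)
    show "conj_J D X Y \<in> vector_fields A"
      if "X \<in> vector_fields A" "Y \<in> vector_fields A" for X Y
      using that by (intro vector_field_uminus J_vector_field VF)
    show "conj_J D (\<lambda>p. tlin (a p) (X p) (b p) (Y p)) Z =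
        (\<lambda>p. tlin (a p) (conj_J D X Z p) (b p) (conj_J D Y Z p))"
      if "X \<in> vector_fields A" "Y \<in> vector_fields A" "Z \<in> vector_fields A"
        "a \<in> smooth_functions A" "b \<in> smooth_functions A" for X Y Z a b
    proof -
      have "D (\<lambda>p. tlin (a p) (X p) (b p) (Y p)) (JF Z) =
          (\<lambda>p. tlin (a p) (D X (JF Z) p) (b p) (D Y (JF Z) p))"
        using D that J_vector_field unfolding linear_connection_def by blast
      then show ?thesis
        using that by (simp add: J_tlin T J_vector_field) (simp add: tlin_def)
    qed
    show "conj_J D X (\<lambda>p. tlin 1 (Y p) 1 (Z p)) =
        (\<lambda>p. tlin 1 (conj_J D X Y p) 1 (conj_J D X Z p))"
      if "X \<in> vector_fields A" "Y \<in> vector_fields A" "Z \<in> vector_fields A" for X Y Z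
    proof -
      have "D X (\<lambda>p. tlin 1 (J p (Y p)) 1 (J p (Z p))) =
          (\<lambda>p. tlin 1 (D X (JF Y) p) 1 (D X (JF Z) p))"
        using D that J_vector_field by (simp add: linear_connection_def)
      then show ?thesis
        using that by (simp add: J_tlin T J_vector_field vector_field_tangent) (simp add: tlin_def)
    qed
    show "conj_J D X (\<lambda>p f. a p * Y p f) =
        (\<lambda>p. tlin (X p a) (Y p) (a p) (conj_J D X Y p))"
      if "X \<in> vector_fields A" "Y \<in> vector_fields A" "a \<in> smooth_functions A" for X Y a
    proof -
      have "J p (\<lambda>f. a p * Y p f) = (\<lambda>f. a p * J p (Y p) f)" for p
        using J_tlin[of "Y p" p "Y p" "a p" 0] that by (simp add: tlin_def vector_field_tangent)
      moreover have "D X (\<lambda>p f. a p * J p (Y p) f) =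
          (\<lambda>p. tlin (X p a) (J p (Y p)) (a p) (D X (JF Y) p))"
        using D that J_vector_field by (simp add: linear_connection_def)
      \<comment> \<open>Applying \<open>- J\<close> to the derivative term \<open>X(a) J Y\<close>
        returns \<open>X(a) Y\<close>, because \<open>- J J\<close> is the identity; this is what
        preserves the Leibniz rule.\<close>
      ultimately show ?thesis
        using that by (simp add: J_tlin T J_vector_field J_tangent J_J vector_field_tangent)
          (simp add: tlin_def)
    qed
  qed
qed

text \<open>The formula for the complex conjugate determines \<open>N\<close> on vector fields, so
  \<open>N\<close> may be replaced there by \<open>conj_J D\<close>. Conversely
  \<open>conj_J D\<close> is itself a linear connection and serves as the witness.\<close>

lemma complex_conjugate_exists_iff:
  assumes "linear_connection A D"
  shows "(\<exists>N. metric_conjugate A h D N \<and> complex_conjugate A J D N) \<longleftrightarrow>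
    (\<forall>X\<in>vector_fields A. \<forall>Y\<in>vector_fields A. \<forall>Z\<in>vector_fields A. \<forall>p.
      X p (\<lambda>q. h q (Y q) (Z q)) = h p (D X Y p) (Z p) + h p (Y p) (conj_J D X Z p))"
  (is "?L \<longleftrightarrow> ?R")
proof
  assume ?L
  then show ?R
    by (auto simp: metric_conjugate_def complex_conjugate_def)
next
  assume ?R
  then have "metric_conjugate A h D (conj_J D) \<and> complex_conjugate A J D (conj_J D)"
    using linear_connection_conj_J[OF assms]
    by (simp add: metric_conjugate_def complex_conjugate_def)
  then show ?L by blast
qed

text \<open>Every field is, up to sign, in the image of \<open>J\<close>: applying the right-hand
  side to \<open>JF Z\<close> gives \<open>P\<close> at \<open>- Z\<close>, and \<open>neg\<close>
  removes the sign. This justifies substituting \<open>J Z\<close> for \<open>Z\<close> as an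
  equivalence.\<close>

lemma vector_field_all_J:
  assumes neg: "\<And>Z. Z \<in> vector_fields A \<Longrightarrow> P (\<lambda>p f. - Z p f) \<Longrightarrow> P Z"
  shows "(\<forall>Z\<in>vector_fields A. P Z) \<longleftrightarrow> (\<forall>Z\<in>vector_fields A. P (JF Z))"
proof
  assume "\<forall>Z\<in>vector_fields A. P Z"
  then show "\<forall>Z\<in>vector_fields A. P (JF Z)"
    using J_vector_field by blast
next
  assume *: "\<forall>Z\<in>vector_fields A. P (JF Z)"
  show "\<forall>Z\<in>vector_fields A. P Z"
  proof
    fix Z assume Z: "Z \<in> vector_fields A"
    have "P (JF (JF Z))"
      using * J_vector_field[OF Z] by (rule bspec)
    then show "P Z"
      using neg[OF Z] by (simp only: JF_JF[OF Z])
  qed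
qed

section \<open>Conjugacy relative to \<open>J\<close> against compatibility with the two
  metrics\<close>

context
  fixes D :: "'a connection"
  assumes D: "linear_connection A D"
begin

lemma connection_tangent:
  "X \<in> vector_fields A \<Longrightarrow> Y \<in> vector_fields A \<Longrightarrow> D X Y p \<in> tangent_space A p"
  using D vector_field_tangent by (auto simp: linear_connection_def)

lemma conj_J_uminus:
  assumes "X \<in> vector_fields A" "Y \<in> vector_fields A"
  shows "conj_J D X (\<lambda>p f. - Y p f) p = (\<lambda>f. - conj_J D X Y p f)"
  using assms
  by (simp add: J_uminus vector_field_tangent linear_connection_uminus[OF D] J_vector_field
      connection_tangent)

text \<open>Two signs cancel: the one in \<open>conj_J\<close> and the one from
  \<open>J J Y = - Y\<close> inside \<open>D X\<close>.\<close>

lemma conj_J_J: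
  assumes "X \<in> vector_fields A" "Y \<in> vector_fields A"
  shows "conj_J D X (JF Y) p = J p (D X Y p)"
  using assms
  by (simp add: J_J J_uminus vector_field_tangent linear_connection_uminus[OF D] connection_tangent)

lemma J_conj_J:
  assumes "X \<in> vector_fields A" "Y \<in> vector_fields A"
  shows "J p (conj_J D X Y p) = D X (JF Y) p"
  using assms by (simp add: J_J J_uminus J_tangent connection_tangent J_vector_field)

lemma g_derivative_uminus:
  assumes "X \<in> vector_fields A" "Y \<in> vector_fields A" "Z \<in> vector_fields A"
  shows "X p (\<lambda>q. - g q (Y q) (Z q)) = - X p (\<lambda>q. g q (Y q) (Z q))"
  using assms by (intro tangent_space_uminus_arg[OF vector_field_tangent g_smooth])

lemma conj_g_eq_conj_J_iff:
  "(\<exists>N. metric_conjugate A g D N \<and> complex_conjugate A J D N) \<longleftrightarrow>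
    metric_conjugate A (associated_metric J g) D D"
proof -
  let ?P = "\<lambda>X Y Z. \<forall>p.
    X p (\<lambda>q. g q (Y q) (Z q)) = g p (D X Y p) (Z p) + g p (Y p) (conj_J D X Z p)"
  \<comment> \<open>Every term of the identity is odd in \<open>Z\<close>, so its validity at
    \<open>- Z\<close> gives it at \<open>Z\<close>.\<close>
  have neg: "?P X Y Z"
    if V: "X \<in> vector_fields A" "Y \<in> vector_fields A" "Z \<in> vector_fields A"
      and P: "?P X Y (\<lambda>p f. - Z p f)" for X Y Z
  proof
    fix p
    have "conj_J D X Z p \<in> tangent_space A p"
      using V by (intro tangent_uminus J_tangent connection_tangent J_vector_field)
    then show "X p (\<lambda>q. g q (Y q) (Z q)) = g p (D X Y p) (Z p) + g p (Y p) (conj_J D X Z p)"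
      using P[rule_format, of p] V
      by (simp only: conj_J_uminus g_derivative_uminus g_uminus_right vector_field_tangent
          connection_tangent)
  qed
  have "(\<forall>Z\<in>vector_fields A. ?P X Y Z) \<longleftrightarrow> (\<forall>Z\<in>vector_fields A. ?P X Y (JF Z))"
    if "X \<in> vector_fields A" "Y \<in> vector_fields A" for X Y
    by (rule vector_field_all_J) (use neg that in blast)
  then show ?thesis
    \<comment> \<open>By \<open>conj_J_J\<close>, the last term of \<open>?P X Y (JF Z)\<close> is
      \<open>g(Y, J (D X Z))\<close>, so the identity is the self-conjugacy of \<open>D\<close> for
      the associated metric.\<close>
    unfolding complex_conjugate_exists_iff[OF D]
    using D by (simp add: metric_conjugate_def associated_metric_def conj_J_J cong: ball_cong)
qed

lemma conj_associated_eq_conj_J_iff: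
  "(\<exists>N. metric_conjugate A (associated_metric J g) D N \<and> complex_conjugate A J D N) \<longleftrightarrow>
    metric_conjugate A g D D"
proof -
  \<comment> \<open>Here \<open>?P\<close> is taken from the right-hand side, the compatibility of
    \<open>D\<close> with \<open>g\<close>. By \<open>J_conj_J\<close>, its instance at
    \<open>JF Z\<close> is the conjugacy condition for the associated metric at \<open>Z\<close>, so
    the overall sign of the opposite substitution does not arise.\<close>
  let ?P = "\<lambda>X Y Z. \<forall>p.
    X p (\<lambda>q. g q (Y q) (Z q)) = g p (D X Y p) (Z p) + g p (Y p) (D X Z p)"
  have neg: "?P X Y Z"
    if V: "X \<in> vector_fields A" "Y \<in> vector_fields A" "Z \<in> vector_fields A"
      and P: "?P X Y (\<lambda>p f. - Z p f)" for X Y Z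
  proof
    fix p
    show "X p (\<lambda>q. g q (Y q) (Z q)) = g p (D X Y p) (Z p) + g p (Y p) (D X Z p)"
      using P[rule_format, of p] V
      by (simp add: g_derivative_uminus g_uminus_right vector_field_tangent
          linear_connection_uminus[OF D] connection_tangent)
  qed
  have "(\<forall>Z\<in>vector_fields A. ?P X Y Z) \<longleftrightarrow> (\<forall>Z\<in>vector_fields A. ?P X Y (JF Z))"
    if "X \<in> vector_fields A" "Y \<in> vector_fields A" for X Y
    by (rule vector_field_all_J) (use neg that in blast)
  then show ?thesis
    unfolding complex_conjugate_exists_iff[OF D]
    using D by (simp add: metric_conjugate_def associated_metric_def J_conj_J cong: ball_cong)
qed

end

end

theorem corollary2p2:
  fixes A :: "('a::{t2_space, second_countable_topology}, 'e::euclidean_space) atlas"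
    and J :: "'a \<Rightarrow> 'a tvec \<Rightarrow> 'a tvec"
    and g :: "'a \<Rightarrow> 'a tvec \<Rightarrow> 'a tvec \<Rightarrow> real"
    and D :: "'a connection"
    and n :: nat
  assumes "almost_norden_manifold n A J g"
    and "linear_connection A D"
    and "torsion_free A D"
  shows "((\<exists>N. metric_conjugate A g D N \<and> complex_conjugate A J D N) \<longleftrightarrow>
            levi_civita_connection A (associated_metric J g) D) \<and>
         ((\<exists>N. metric_conjugate A (associated_metric J g) D N \<and> complex_conjugate A J D N) \<longleftrightarrow>
            levi_civita_connection A g D)"
proof -
  interpret almost_norden n A J g
    by unfold_locales (rule assms(1))
  show ?thesis
    using assms(3) conj_g_eq_conj_J_iff[OF assms(2)] conj_associated_eq_conj_J_iff[OF assms(2)]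
    by (simp add: levi_civita_connection_iff_metric_conjugate_self)
qed

end
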